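(* Let $\mathfrak C$ be a class of finite groups which is closed for subgroups, quotients and direct products, and let $G$ be a profinite group. If $G$ is $\mathfrak C$-positive, then $P_{\mathfrak C}(G,G)>0$.
   Context: Classes of finite groups are closed under isomorphism; direct products means finite direct products. For elements $x,y$ of a profinite group $G$, $\langle x,y\rangle$ denotes the closed subgroup they generate. A profinite group is pro-$\mathfrak C$ if all its quotients by open normal subgroups belong to $\mathfrak C$. Let $\mu$ be the normalized Haar measure on $G$ (and on $G\times G$). For $x\in G$ put $\Omega_{\mathfrak C}(x,G)=\{g\in G \mid \langle x,g\rangle \text{ is a pro-}\mathfrak C\text{ group}\}$, a closed subset of $G$, and $P_{\mathfrak C}(x,G)=\mu(\Omega_{\mathfrak C}(x,G))$. The group $G$ is $\mathfrak C$-positive if $P_{\mathfrak C}(x,G)>0$ for all $x\in G$. $P_{\mathfrak C}(G,G)=\mu(\{(x,y)\in G\times G \mid \langle x,y\rangle \text{ is a pro-}\mathfrak C\text{ group}\})$ is the probability that two randomly chosen elements of $G$ generate a pro-$\mathfrak C$ subgroup. *)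

theory Defs
  imports "HOL-Algebra.Algebra" "HOL-Analysis.Analysis"
begin

text \<open>A finite group is isomorphic to one whose elements are natural numbers, so an
  isomorphism-closed class of finite groups is given by its members with carrier in \<^typ>\<open>nat\<close>.
  Membership of a group over any other type is membership up to isomorphism.\<close>

definition finite_group_class :: "nat monoid set \<Rightarrow> bool" where
  "finite_group_class C \<longleftrightarrow>
     (\<forall>K\<in>C. group K \<and> finite (carrier K)) \<and>
     (\<forall>K\<in>C. \<forall>L :: nat monoid. group L \<and> K \<cong> L \<longrightarrow> L \<in> C)"

definition in_class :: "nat monoid set \<Rightarrow> ('a, 'b) monoid_scheme \<Rightarrow> bool" where
  "in_class C H \<longleftrightarrow> group H \<and> (\<exists>K\<in>C. H \<cong> K)"

definition subgroup_closed :: "nat monoid set \<Rightarrow> bool" where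
  "subgroup_closed C \<longleftrightarrow> (\<forall>K\<in>C. \<forall>H. subgroup H K \<longrightarrow> in_class C (K\<lparr>carrier := H\<rparr>))"

definition quotient_closed :: "nat monoid set \<Rightarrow> bool" where
  "quotient_closed C \<longleftrightarrow> (\<forall>K\<in>C. \<forall>N. N \<lhd> K \<longrightarrow> in_class C (K Mod N))"

definition product_closed :: "nat monoid set \<Rightarrow> bool" where
  "product_closed C \<longleftrightarrow>
     (\<forall>(I :: nat set) F. finite I \<and> (\<forall>i\<in>I. F i \<in> C) \<longrightarrow> in_class C (product_group I F))"

definition topological_group :: "('a, 'b) monoid_scheme \<Rightarrow> 'a topology \<Rightarrow> bool" where
  "topological_group G T \<longleftrightarrow>
     group G \<and> topspace T = carrier G \<and>
     continuous_map (prod_topology T T) T (\<lambda>(x, y). x \<otimes>\<^bsub>G\<^esub> y) \<and>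
     continuous_map T T (\<lambda>x. inv\<^bsub>G\<^esub> x)"

definition profinite_group :: "('a, 'b) monoid_scheme \<Rightarrow> 'a topology \<Rightarrow> bool" where
  "profinite_group G T \<longleftrightarrow>
     topological_group G T \<and> compact_space T \<and> Hausdorff_space T \<and>
     (\<forall>S. connectedin T S \<longrightarrow> (\<exists>a. S \<subseteq> {a}))"

definition pro_class :: "nat monoid set \<Rightarrow> ('a, 'b) monoid_scheme \<Rightarrow> 'a topology \<Rightarrow> bool" where
  "pro_class C G T \<longleftrightarrow>
     profinite_group G T \<and> (\<forall>N. N \<lhd> G \<and> openin T N \<longrightarrow> in_class C (G Mod N))"

definition closed_generate ::
    "('a, 'b) monoid_scheme \<Rightarrow> 'a topology \<Rightarrow> 'a set \<Rightarrow> 'a set" where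
  "closed_generate G T S = \<Inter>{H. subgroup H G \<and> closedin T H \<and> S \<subseteq> H}"

definition generates_pro_class ::
    "nat monoid set \<Rightarrow> ('a, 'b) monoid_scheme \<Rightarrow> 'a topology \<Rightarrow> 'a \<Rightarrow> 'a \<Rightarrow> bool" where
  "generates_pro_class C G T x y \<longleftrightarrow>
     (let H = closed_generate G T {x, y}
      in pro_class C (G\<lparr>carrier := H\<rparr>) (subtopology T H))"

text \<open>Haar measure as a Radon measure on the full Borel \<open>\<sigma>\<close>-algebra: \<open>T\<close> need not be second
  countable, so regularity does not follow from finiteness. For the same reason the Borel
  \<open>\<sigma>\<close>-algebra of \<open>G \<times> G\<close> can be larger than the product \<open>\<sigma>\<close>-algebra, and the Haar measure of
  \<open>G \<times> G\<close> is that of the group \<^term>\<open>G \<times>\<times> G\<close> with its product topology rather than the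
  product measure \<^const>\<open>pair_measure\<close>.\<close>

definition normalized_haar ::
    "('a, 'b) monoid_scheme \<Rightarrow> 'a topology \<Rightarrow> 'a measure \<Rightarrow> bool" where
  "normalized_haar G T \<mu> \<longleftrightarrow>
     space \<mu> = carrier G \<and>
     sets \<mu> = sigma_sets (carrier G) {U. openin T U} \<and>
     emeasure \<mu> (carrier G) = 1 \<and>
     (\<forall>g\<in>carrier G. \<forall>A\<in>sets \<mu>. emeasure \<mu> (g <#\<^bsub>G\<^esub> A) = emeasure \<mu> A) \<and>
     (\<forall>A\<in>sets \<mu>. emeasure \<mu> A = (INF U\<in>{U. openin T U \<and> A \<subseteq> U}. emeasure \<mu> U)) \<and>
     (\<forall>U. openin T U \<longrightarrow>
        emeasure \<mu> U = (SUP K\<in>{K. compactin T K \<and> K \<subseteq> U}. emeasure \<mu> K))"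

definition Omega ::
    "nat monoid set \<Rightarrow> ('a, 'b) monoid_scheme \<Rightarrow> 'a topology \<Rightarrow> 'a \<Rightarrow> 'a set" where
  "Omega C G T x = {g \<in> carrier G. generates_pro_class C G T x g}"

definition P_elem ::
    "nat monoid set \<Rightarrow> ('a, 'b) monoid_scheme \<Rightarrow> 'a topology \<Rightarrow> 'a measure \<Rightarrow> 'a \<Rightarrow> real" where
  "P_elem C G T \<mu> x = measure \<mu> (Omega C G T x)"

definition P_group ::
    "nat monoid set \<Rightarrow> ('a, 'b) monoid_scheme \<Rightarrow> 'a topology \<Rightarrow> ('a \<times> 'a) measure \<Rightarrow> real" where
  "P_group C G T \<nu> =
     measure \<nu> {(x, y) \<in> carrier G \<times> carrier G. generates_pro_class C G T x y}"

definition class_positive ::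
    "nat monoid set \<Rightarrow> ('a, 'b) monoid_scheme \<Rightarrow> 'a topology \<Rightarrow> 'a measure \<Rightarrow> bool" where
  "class_positive C G T \<mu> \<longleftrightarrow> (\<forall>x\<in>carrier G. P_elem C G T \<mu> x > 0)"

end

theory Submission
  imports Defs
begin

text \<open>
  For an open normal subgroup \<open>N\<close> of \<open>G\<close> let \<open>W N\<close> be the set of pairs \<open>(x, y)\<close> whose images in the
  finite group \<open>G/N\<close> generate a member of the class. Being a union of products of cosets of \<open>N\<close>, the
  set \<open>W N\<close> is clopen. Since the open normal subgroups form a base of neighbourhoods of the identity
  (\<open>open_normal_subset\<close>) and the class is closed under quotients, \<open>x\<close> and \<open>y\<close> generate a
  pro-\<open>C\<close> group iff \<open>(x, y)\<close> lies in every \<open>W N\<close> (\<open>generates_pro_class_iff\<close>).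

  Let \<open>E m\<close> be the set of all \<open>x\<close> such that every \<open>W N\<close> has a fibre of measure at least
  \<open>1/(m + 1)\<close> over \<open>x\<close>. The sets \<open>E m\<close> are closed, and as the fibre contains \<open>\<Omega>(x, G)\<close>, positivity
  of \<open>P(x, G)\<close> for all \<open>x\<close> says that they cover \<open>G\<close>. By countable additivity some \<open>E m\<close> has positive
  measure \<open>d\<close>. Counting cosets (\<open>measure_ge_of_fibres_ge\<close>) gives \<open>\<nu> (W N) \<ge> d/(m + 1)\<close>, a bound
  that does not depend on \<open>N\<close>.

  The sets \<open>W N\<close> are closed and directed downwards, so by compactness each open set containing their
  intersection contains some \<open>W N\<close> (\<open>directed_closed_subset_open\<close>). Outer regularity of \<open>\<nu>\<close>
  carries the bound over to the intersection. The only sets to which Fubini's theorem would have to be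
  applied are finite unions of products of cosets, where it is a count; hence the product
  \<open>\<sigma>\<close>-algebra never enters.
\<close>

section \<open>Homomorphic images of members of a class\<close>

lemma in_class_iso:
  assumes "in_class C A" "A \<cong> B" "group B"
  shows "in_class C B"
proof -
  obtain K where K: "K \<in> C" "A \<cong> K" "group A"
    using assms(1) by (auto simp: in_class_def)
  have "B \<cong> A"
    using group.iso_sym[OF K(3) assms(2)] .
  then show ?thesis
    using K(1) iso_trans[OF _ K(2)] assms(3) by (auto simp: in_class_def)
qed

lemma in_class_hom_image:
  assumes C: "finite_group_class C" "quotient_closed C"
    and A: "in_class C A" and B: "group B"
    and h: "h \<in> hom A B" "h ` carrier A = carrier B"
  shows "in_class C B"
proof -
  obtain K where K: "K \<in> C" "A \<cong> K" "group A"
    using A by (auto simp: in_class_def)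
  have gK: "group K"
    using C(1) K(1) by (auto simp: finite_group_class_def)
  obtain f where f: "f \<in> iso K A"
    using group.iso_sym[OF K(3) K(2)] by (auto simp: is_iso_def)
  then have fh: "f \<in> hom K A" "f ` carrier K = carrier A"
    by (auto simp: iso_def bij_betw_def)
  interpret group_hom K B "h \<circ> f"
    using gK B hom_compose[OF fh(1) h(1)] by (simp add: group_hom_def group_hom_axioms_def)
  have "(h \<circ> f) ` carrier K = carrier B"
    using fh(2) h(2) by (simp only: image_comp[symmetric])
  from FactGroup_iso[OF this] have "K Mod kernel K B (h \<circ> f) \<cong> B" .
  moreover have "in_class C (K Mod kernel K B (h \<circ> f))"
    using C(2) K(1) normal_kernel by (auto simp: quotient_closed_def)
  ultimately show ?thesis
    using in_class_iso B by blast
qed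

text \<open>If \<open>ker f \<subseteq> ker p\<close> for epimorphisms \<open>f : H \<rightarrow> A\<close> and \<open>p : H \<rightarrow> B\<close>, then \<open>B\<close> is a
  homomorphic image of \<open>A\<close>.\<close>

lemma in_class_of_kernel_subset:
  assumes C: "finite_group_class C" "quotient_closed C"
    and grp: "group H" "group A" "group B" and A: "in_class C A"
    and f: "f \<in> hom H A" "f ` carrier H = carrier A"
    and p: "p \<in> hom H B" "p ` carrier H = carrier B"
    and ker: "\<And>x. \<lbrakk>x \<in> carrier H; f x = \<one>\<^bsub>A\<^esub>\<rbrakk> \<Longrightarrow> p x = \<one>\<^bsub>B\<^esub>"
  shows "in_class C B"
proof -
  interpret f: group_hom H A f
    using grp f by (simp add: group_hom_def group_hom_axioms_def)
  interpret p: group_hom H B p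
    using grp p by (simp add: group_hom_def group_hom_axioms_def)
  let ?K = "kernel H A f"
  have Q: "group (H Mod ?K)"
    using f.normal_kernel normal.factorgroup_is_group by blast
  have "A \<cong> H Mod ?K"
    using group.iso_sym[OF Q f.FactGroup_iso[OF f(2)]] .
  then have inQ: "in_class C (H Mod ?K)"
    using in_class_iso A Q by blast
  have "?K \<subseteq> kernel H B p"
    using ker by (auto simp: kernel_def)
  then obtain g where g: "g \<in> hom (H Mod ?K) B"
      "\<And>x. x \<in> carrier H \<Longrightarrow> g (?K #>\<^bsub>H\<^esub> x) = p x"
    using p.FactGroup_universal_kernel[OF f.normal_kernel] by metis
  have "carrier (H Mod ?K) = (\<lambda>x. ?K #>\<^bsub>H\<^esub> x) ` carrier H"
    by (auto simp: FactGroup_def RCOSETS_def)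
  then have "g ` carrier (H Mod ?K) = carrier B"
    using g(2) p(2) by (auto simp: image_image)
  then show ?thesis
    by (rule in_class_hom_image[OF C inQ grp(3) g(1)])
qed

section \<open>Compact spaces\<close>

text \<open>A form of the tube lemma.\<close>

lemma openin_forall_compact:
  assumes "compact_space Z" "openin (prod_topology Z Y) E"
  shows "openin Y {y \<in> topspace Y. \<forall>x\<in>topspace Z. (x, y) \<in> E}"
proof -
  let ?D = "topspace (prod_topology Z Y) - E"
  have "closedin (prod_topology Z Y) ?D"
    using assms(2) by blast
  then have "closedin Y (snd ` ?D)"
    using closed_map_snd[OF assms(1), of Y] unfolding closed_map_def by blast
  moreover have "{y \<in> topspace Y. \<forall>x\<in>topspace Z. (x, y) \<in> E} = topspace Y - snd ` ?D"
    by force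
  ultimately show ?thesis
    by (metis openin_diff openin_topspace)
qed

lemma directed_closed_subset_open:
  assumes Y: "compact_space Y" and F: "F \<noteq> {}" "\<And>N. N \<in> F \<Longrightarrow> closedin Y (W N)"
    and dir: "\<And>M N. \<lbrakk>M \<in> F; N \<in> F\<rbrakk> \<Longrightarrow> \<exists>L\<in>F. W L \<subseteq> W M \<inter> W N"
    and U: "openin Y U" "\<Inter>(W ` F) \<subseteq> U"
  shows "\<exists>N\<in>F. W N \<subseteq> U"
proof (rule ccontr)
  assume no: "\<not> ?thesis"
  have lower: "\<exists>L\<in>F. \<forall>N\<in>D. W L \<subseteq> W N" if "finite D" "D \<subseteq> F" for D
    using that
  proof (induction D)
    case empty
    then show ?case using F(1) by auto
  next
    case (insert M D)
    then obtain L where L: "L \<in> F" "\<forall>N\<in>D. W L \<subseteq> W N"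
      by auto
    obtain L' where "L' \<in> F" "W L' \<subseteq> W L \<inter> W M"
      using dir[OF L(1), of M] insert.prems by auto
    with L(2) show ?case
      by (intro bexI[of _ L']) auto
  qed
  have "\<forall>C\<in>(\<lambda>N. W N - U) ` F. closedin Y C"
    using F(2) U(1) by (auto intro: closedin_diff)
  moreover have "\<Inter>\<C> \<noteq> {}" if C: "finite \<C>" "\<C> \<subseteq> (\<lambda>N. W N - U) ` F" for \<C>
  proof -
    obtain D where D: "D \<subseteq> F" "finite D" "\<C> = (\<lambda>N. W N - U) ` D"
      using finite_subset_image[OF C] by blast
    obtain L where L: "L \<in> F" "\<forall>N\<in>D. W L \<subseteq> W N"
      using lower[OF D(2,1)] by auto
    have "W L - U \<noteq> {}"
      using no L(1) by auto
    with L(2) D(3) show ?thesis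
      by blast
  qed
  ultimately have "\<Inter>((\<lambda>N. W N - U) ` F) \<noteq> {}"
    using Y[unfolded compact_space_fip, rule_format, of "(\<lambda>N. W N - U) ` F"] by simp
  with F(1) U(2) show False
    by blast
qed

section \<open>Profinite groups\<close>

text \<open>A profinite group \<open>G\<close> with topology \<open>T\<close>; the group laws of \<open>G\<close> become available.\<close>

locale profinite =
  fixes G :: "('a, 'b) monoid_scheme" (structure) and T :: "'a topology"
  assumes profinite: "profinite_group G T"
begin

lemma topological: "topological_group G T"
  using profinite by (simp add: profinite_group_def)

sublocale group G
  using topological by (simp add: topological_group_def)

lemma topspace [simp]: "topspace T = carrier G"
  using topological by (simp add: topological_group_def)

lemma compact: "compact_space T" and Hausdorff: "Hausdorff_space T"
  using profinite by (auto simp: profinite_group_def)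

lemma continuous_mult:
  assumes "continuous_map Y T f" "continuous_map Y T g"
  shows "continuous_map Y T (\<lambda>x. f x \<otimes> g x)"
proof -
  have "continuous_map (prod_topology T T) T (\<lambda>(x, y). x \<otimes> y)"
    using topological by (simp add: topological_group_def)
  moreover have "continuous_map Y (prod_topology T T) (\<lambda>x. (f x, g x))"
    using assms by (simp add: continuous_map_pairedI)
  ultimately show ?thesis
    using continuous_map_compose[of Y "prod_topology T T" "\<lambda>x. (f x, g x)" T "\<lambda>(x, y). x \<otimes> y"]
    by (simp add: o_def)
qed

lemma openin_translate:
  assumes "openin T U" "g \<in> carrier G"
  shows "openin T (g <# U)"
proof -
  have U: "U \<subseteq> carrier G"
    using assms(1) openin_subset by fastforce
  have "g <# U = {x \<in> topspace T. inv g \<otimes> x \<in> U}"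
  proof (intro equalityI subsetI)
    fix x assume "x \<in> g <# U"
    then show "x \<in> {x \<in> topspace T. inv g \<otimes> x \<in> U}"
      using U assms(2) by (auto simp: l_coset_def m_assoc[symmetric] subset_eq)
  next
    fix x assume x: "x \<in> {x \<in> topspace T. inv g \<otimes> x \<in> U}"
    then have "x = g \<otimes> (inv g \<otimes> x)"
      using assms(2) by (simp add: m_assoc[symmetric])
    with x show "x \<in> g <# U"
      by (auto simp: l_coset_def)
  qed
  moreover have "continuous_map T T (\<lambda>x. inv g \<otimes> x)"
    using assms(2) by (intro continuous_mult) auto
  ultimately show ?thesis
    using openin_continuous_map_preimage[OF _ assms(1), of T "\<lambda>x. inv g \<otimes> x"] by simp
qed

text \<open>Total disconnectedness yields a clopen set \<open>K\<close> with \<open>\<one> \<in> K \<subseteq> U\<close>. The elements that can be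
  inserted into any product of two factors without changing whether it belongs to \<open>K\<close> form the
  required subgroup: it is normal for algebraic reasons, open because the two factors range over a
  compact space, and contained in \<open>K\<close> because \<open>\<one> \<in> K\<close>.\<close>

lemma open_normal_subset:
  assumes U: "openin T U" "\<one> \<in> U"
  obtains N where "N \<lhd> G" "openin T N" "N \<subseteq> U"
proof -
  have "separated_between T {\<one>} (carrier G - U)"
  proof (rule cut_wire_fence_theorem[OF compact Hausdorff])
    show "closedin T {\<one>}"
      using Hausdorff Hausdorff_imp_t1_space closedin_t1_singleton by fastforce
    show "closedin T (carrier G - U)"
      using U(1) by (metis closedin_diff closedin_topspace topspace)
    fix S assume "connectedin T S"
    then obtain a where "S \<subseteq> {a}"
      using profinite by (auto simp: profinite_group_def)
    then show "disjnt S {\<one>} \<or> disjnt S (carrier G - U)"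
      using U(2) by (auto simp: disjnt_def)
  qed
  then obtain K where K: "closedin T K" "openin T K" "\<one> \<in> K" "carrier G - U \<subseteq> carrier G - K"
    by (auto simp: separated_between)
  define N where "N = {n \<in> carrier G. \<forall>a\<in>carrier G. \<forall>b\<in>carrier G. a \<otimes> n \<otimes> b \<in> K \<longleftrightarrow> a \<otimes> b \<in> K}"
  have "subgroup N G"
  proof
    show "N \<subseteq> carrier G" "\<one> \<in> N"
      by (auto simp: N_def)
    fix m n assume mn: "m \<in> N" "n \<in> N"
    have "a \<otimes> (m \<otimes> n) \<otimes> b \<in> K \<longleftrightarrow> a \<otimes> b \<in> K" if "a \<in> carrier G" "b \<in> carrier G" for a b
    proof -
      have "a \<otimes> (m \<otimes> n) \<otimes> b \<in> K \<longleftrightarrow> (a \<otimes> m) \<otimes> n \<otimes> b \<in> K"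
        using mn that by (simp add: N_def m_assoc)
      also have "\<dots> \<longleftrightarrow> a \<otimes> m \<otimes> b \<in> K"
        using mn that by (simp add: N_def)
      also have "\<dots> \<longleftrightarrow> a \<otimes> b \<in> K"
        using mn that by (simp add: N_def)
      finally show ?thesis .
    qed
    then show "m \<otimes> n \<in> N"
      using mn by (simp add: N_def)
  next
    fix n assume n: "n \<in> N"
    have "a \<otimes> inv n \<otimes> b \<in> K \<longleftrightarrow> a \<otimes> b \<in> K" if "a \<in> carrier G" "b \<in> carrier G" for a b
    proof -
      have nG: "n \<in> carrier G" and *: "(a \<otimes> inv n) \<otimes> n \<otimes> b \<in> K \<longleftrightarrow> a \<otimes> inv n \<otimes> b \<in> K"
        using n that by (auto simp: N_def)
      have "(a \<otimes> inv n) \<otimes> n \<otimes> b = a \<otimes> b"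
        using nG that by (simp add: m_assoc)
      with * show ?thesis by simp
    qed
    then show "inv n \<in> N"
      using n by (simp add: N_def)
  qed
  moreover have "g \<otimes> n \<otimes> inv g \<in> N" if "g \<in> carrier G" "n \<in> N" for g n
  proof -
    have n: "n \<in> carrier G" "\<And>a b. \<lbrakk>a \<in> carrier G; b \<in> carrier G\<rbrakk> \<Longrightarrow> a \<otimes> n \<otimes> b \<in> K \<longleftrightarrow> a \<otimes> b \<in> K"
      using that by (auto simp: N_def)
    have "a \<otimes> (g \<otimes> n \<otimes> inv g) \<otimes> b \<in> K \<longleftrightarrow> a \<otimes> b \<in> K" if "a \<in> carrier G" "b \<in> carrier G" for a b
    proof -
      have "a \<otimes> (g \<otimes> n \<otimes> inv g) \<otimes> b \<in> K \<longleftrightarrow> (a \<otimes> g) \<otimes> n \<otimes> (inv g \<otimes> b) \<in> K"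
        using \<open>g \<in> carrier G\<close> n(1) that by (simp add: m_assoc)
      also have "\<dots> \<longleftrightarrow> (a \<otimes> g) \<otimes> (inv g \<otimes> b) \<in> K"
        using \<open>g \<in> carrier G\<close> that by (intro n(2)) auto
      also have "(a \<otimes> g) \<otimes> (inv g \<otimes> b) = a \<otimes> (g \<otimes> inv g) \<otimes> b"
        using \<open>g \<in> carrier G\<close> that by (simp only: m_assoc inv_closed m_closed)
      also have "\<dots> = a \<otimes> b"
        using \<open>g \<in> carrier G\<close> that by simp
      finally show ?thesis .
    qed
    then show ?thesis
      using that n(1) by (simp add: N_def)
  qed
  ultimately have "N \<lhd> G"
    by (rule normal_invI)
  moreover have "openin T N"
  proof -
    let ?GG = "prod_topology T T" and ?X = "prod_topology (prod_topology T T) T"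
    let ?f = "\<lambda>z. fst (fst z) \<otimes> snd z \<otimes> snd (fst z)" and ?g = "\<lambda>z. fst (fst z) \<otimes> snd (fst z)"
    have c1: "continuous_map ?X T (\<lambda>z. fst (fst z))"
      using continuous_map_compose[OF continuous_map_fst continuous_map_fst] by (simp add: o_def)
    have c2: "continuous_map ?X T (\<lambda>z. snd (fst z))"
      using continuous_map_compose[OF continuous_map_fst continuous_map_snd] by (simp add: o_def)
    have f: "continuous_map ?X T ?f" and g: "continuous_map ?X T ?g"
      by (intro continuous_mult c1 c2 continuous_map_snd)+
    have K': "openin T (carrier G - K)"
      using K(1) by (simp add: closedin_def)
    \<comment> \<open>the points \<open>((a, b), n)\<close> at which \<open>a \<otimes> n \<otimes> b \<in> K\<close> and \<open>a \<otimes> b \<in> K\<close> are equivalent\<close>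
    define E where "E = ({z \<in> topspace ?X. ?f z \<in> K} \<inter> {z \<in> topspace ?X. ?g z \<in> K}) \<union>
        ({z \<in> topspace ?X. ?f z \<in> carrier G - K} \<inter> {z \<in> topspace ?X. ?g z \<in> carrier G - K})"
    have "openin ?X E"
      unfolding E_def
      by (intro openin_Un openin_Int openin_continuous_map_preimage[OF f]
          openin_continuous_map_preimage[OF g] K(2) K')
    then have "openin T {n \<in> topspace T. \<forall>c\<in>topspace ?GG. (c, n) \<in> E}"
      using compact by (intro openin_forall_compact) (simp add: compact_space_prod_topology)
    moreover have E: "((a, b), n) \<in> E \<longleftrightarrow> (a \<otimes> n \<otimes> b \<in> K \<longleftrightarrow> a \<otimes> b \<in> K)"
      if "a \<in> carrier G" "b \<in> carrier G" "n \<in> carrier G" for a b n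
      using that unfolding E_def by simp blast
    have "{n \<in> topspace T. \<forall>c\<in>topspace ?GG. (c, n) \<in> E} = N"
      unfolding N_def using E by auto
    ultimately show ?thesis
      by simp
  qed
  moreover have "N \<subseteq> U"
  proof
    fix n assume "n \<in> N"
    then have "\<one> \<otimes> n \<otimes> \<one> \<in> K \<longleftrightarrow> \<one> \<otimes> \<one> \<in> K" "n \<in> carrier G"
      unfolding N_def by blast+
    then show "n \<in> U"
      using K(3,4) by auto
  qed
  ultimately show thesis
    using that by blast
qed

lemma openin_rcoset:
  assumes "N \<lhd> G" "openin T N" "A \<in> rcosets N"
  shows "openin T A"
proof -
  obtain g where "g \<in> carrier G" "A = N #> g"
    using assms(3) by (auto simp: RCOSETS_def)
  then show ?thesis
    using openin_translate[OF assms(2)] normal.coset_eq[OF assms(1)] by auto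
qed

lemma openin_Union_rcosets:
  assumes "N \<lhd> G" "openin T N" "\<A> \<subseteq> rcosets N"
  shows "openin T (\<Union>\<A>)"
  using assms openin_rcoset by (intro openin_Union) auto

lemma Union_rcosets_Diff:
  assumes N: "N \<lhd> G" and A: "\<A> \<subseteq> rcosets N"
  shows "carrier G - \<Union>\<A> = \<Union>(rcosets N - \<A>)"
proof -
  have 1: "\<Union>(rcosets N) = carrier G" and 2: "pairwise disjnt (rcosets N)"
    using rcosets_part_G rcos_disjoint normal_imp_subgroup[OF N] by auto
  have 3: "A = B" if "A \<in> rcosets N" "B \<in> rcosets N" "x \<in> A" "x \<in> B" for A B x
    using pairwiseD[OF 2 that(1,2)] that(3,4) by (auto simp: disjnt_iff)
  show ?thesis
    unfolding 1[symmetric] using A 3 by blast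
qed

lemma closedin_Union_rcosets:
  assumes "N \<lhd> G" "openin T N" "\<A> \<subseteq> rcosets N"
  shows "closedin T (\<Union>\<A>)"
proof -
  have "openin T (carrier G - \<Union>\<A>)"
    using openin_Union_rcosets[OF assms(1,2), of "rcosets N - \<A>"] Union_rcosets_Diff[OF assms(1,3)]
    by auto
  moreover have "\<Union>\<A> \<subseteq> carrier G"
    using openin_Union_rcosets[OF assms] openin_subset by fastforce
  ultimately show ?thesis
    by (simp add: closedin_def)
qed

lemma finite_rcosets:
  assumes N: "N \<lhd> G" "openin T N"
  shows "finite (rcosets N)"
proof -
  have sg: "subgroup N G"
    by (rule normal_imp_subgroup[OF N(1)])
  have "\<forall>U\<in>rcosets N. openin T U" "\<Union>(rcosets N) = topspace T"
    using openin_rcoset[OF N] rcosets_part_G[OF sg] by auto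
  then obtain \<F> where F: "finite \<F>" "\<F> \<subseteq> rcosets N" "\<Union>\<F> = carrier G"
    using compact[unfolded compact_space, rule_format, of "rcosets N"] by auto
  have "\<Union>(rcosets N - \<F>) = {}"
    using Union_rcosets_Diff[OF N(1) F(2)] F(3) by simp
  then have "rcosets N - \<F> = {}"
    using subgroup.rcosets_non_empty[OF sg] by blast
  then show ?thesis
    using F(1,2) by (metis Diff_eq_empty_iff finite_subset)
qed

lemma closed_subgroup_profinite:
  assumes H: "subgroup H G" "closedin T H"
  shows "profinite_group (G\<lparr>carrier := H\<rparr>) (subtopology T H)"
proof -
  let ?T = "subtopology T H"
  have HG: "H \<subseteq> carrier G"
    using H(1) subgroup.subset by blast
  have top: "topspace ?T = H"
    using HG by auto
  have "continuous_map (prod_topology ?T ?T) ?T (\<lambda>(x, y). x \<otimes> y)"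
  proof -
    have "continuous_map (prod_topology T T) T (\<lambda>(x, y). x \<otimes> y)"
      using topological by (simp add: topological_group_def)
    then have "continuous_map (prod_topology ?T ?T) T (\<lambda>(x, y). x \<otimes> y)"
      by (simp add: prod_topology_subtopology continuous_map_from_subtopology)
    moreover have "(\<lambda>(x, y). x \<otimes> y) \<in> topspace (prod_topology ?T ?T) \<rightarrow> H"
      using H(1) by (auto intro: subgroup.m_closed)
    ultimately show ?thesis
      by (simp add: continuous_map_in_subtopology image_subset_iff_funcset)
  qed
  moreover have "continuous_map ?T ?T (\<lambda>x. inv\<^bsub>G\<lparr>carrier := H\<rparr>\<^esub> x)"
  proof -
    have "continuous_map T T (\<lambda>x. inv x)"
      using topological by (simp add: topological_group_def)
    then have "continuous_map ?T ?T (\<lambda>x. inv x)"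
      using H(1) by (auto simp: continuous_map_in_subtopology continuous_map_from_subtopology
          subgroup.m_inv_closed)
    then show ?thesis
      by (rule continuous_map_eq) (use H(1) m_inv_consistent in auto)
  qed
  moreover have "group (G\<lparr>carrier := H\<rparr>)"
    using H(1) subgroup.subgroup_is_group group_axioms by blast
  ultimately have "topological_group (G\<lparr>carrier := H\<rparr>) ?T"
    using top by (simp add: topological_group_def)
  moreover have "compact_space ?T"
    using H(2) closedin_compact_space[OF compact] compact_space_subtopology by blast
  moreover have "Hausdorff_space ?T"
    using Hausdorff Hausdorff_space_subtopology by blast
  moreover have "\<exists>a. S \<subseteq> {a}" if "connectedin ?T S" for S
    using that profinite by (auto simp: profinite_group_def connectedin_subtopology)
  ultimately show ?thesis
    by (simp add: profinite_group_def)
qed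

lemma closed_generate:
  assumes "S \<subseteq> carrier G"
  shows "subgroup (closed_generate G T S) G" "closedin T (closed_generate G T S)"
    "S \<subseteq> closed_generate G T S"
proof -
  let ?F = "{H. subgroup H G \<and> closedin T H \<and> S \<subseteq> H}"
  have ne: "?F \<noteq> {}"
    using assms subgroup_self closedin_topspace[of T] by auto
  show "subgroup (closed_generate G T S) G"
    unfolding closed_generate_def by (rule subgroups_Inter) (use ne in auto)
  show "closedin T (closed_generate G T S)"
    unfolding closed_generate_def by (rule closedin_Inter) (use ne in auto)
  show "S \<subseteq> closed_generate G T S"
    by (auto simp: closed_generate_def)
qed

end

section \<open>Generation of pro-C subgroups in finite quotients\<close>

text \<open>The subgroup of \<open>G/N\<close> generated by \<open>A\<close> and \<open>B\<close> belongs to the class. The arguments are cosets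
  rather than representatives, so that the pairs with this property can be counted.\<close>

definition cosets_generate ::
    "nat monoid set \<Rightarrow> ('a, 'b) monoid_scheme \<Rightarrow> 'a set \<Rightarrow> 'a set \<Rightarrow> 'a set \<Rightarrow> bool" where
  "cosets_generate C G N A B \<longleftrightarrow>
     in_class C ((G Mod N)\<lparr>carrier := generate (G Mod N) {A, B}\<rparr>)"

context profinite
begin

text \<open>In the finite quotient \<open>G/N\<close> no closure is needed, because preimages of its subgroups are
  clopen.\<close>

lemma image_closed_generate:
  assumes N: "N \<lhd> G" "openin T N" and xy: "x \<in> carrier G" "y \<in> carrier G"
  shows "(\<lambda>g. N #> g) ` closed_generate G T {x, y} = generate (G Mod N) {N #> x, N #> y}"
proof
  interpret N: normal N G by (rule N(1))
  interpret Q: group "G Mod N" by (rule N.factorgroup_is_group)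
  interpret q: group_hom G "G Mod N" "\<lambda>g. N #> g"
    using N.r_coset_hom_Mod by unfold_locales
  let ?H = "closed_generate G T {x, y}" and ?A = "generate (G Mod N) {N #> x, N #> y}"
  have xyQ: "{N #> x, N #> y} \<subseteq> carrier (G Mod N)"
    using xy q.hom_closed by blast
  have A: "subgroup ?A (G Mod N)"
    using Q.generate_is_subgroup[OF xyQ] .
  have UA: "\<Union>?A = {g \<in> carrier G. N #> g \<in> ?A}"
    by (rule N.factgroup_subgroup_union_char[OF A])
  have "subgroup (\<Union>?A) G"
    by (rule N.factgroup_subgroup_union_subgroup[OF A])
  moreover have "closedin T (\<Union>?A)"
    using closedin_Union_rcosets[OF N, of ?A] subgroup.subset[OF A] by (simp add: FactGroup_def)
  moreover have "{x, y} \<subseteq> \<Union>?A"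
    unfolding UA using xy by (auto intro: generate.incl)
  ultimately have "?H \<subseteq> \<Union>?A"
    unfolding closed_generate_def by blast
  then show "(\<lambda>g. N #> g) ` ?H \<subseteq> ?A"
    unfolding UA by blast
  have H: "subgroup ?H G" "{x, y} \<subseteq> ?H"
    using closed_generate[of "{x, y}"] xy by auto
  show "?A \<subseteq> (\<lambda>g. N #> g) ` ?H"
    using H(2) by (intro Q.generate_subgroup_incl q.subgroup_img_is_subgroup[OF H(1)]) auto
qed

text \<open>The quotient map restricts to an epimorphism from the closed subgroup \<open>H\<close> generated by \<open>x\<close> and \<open>y\<close>
  onto the subgroup \<open>R\<close> generated by their cosets.\<close>

lemma cosets_generate_group:
  assumes N: "N \<lhd> G" "openin T N" and xy: "x \<in> carrier G" "y \<in> carrier G"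
  defines "H \<equiv> closed_generate G T {x, y}"
    and "R \<equiv> (G Mod N)\<lparr>carrier := generate (G Mod N) {N #> x, N #> y}\<rparr>"
  shows "group R" "(\<lambda>g. N #> g) \<in> hom (G\<lparr>carrier := H\<rparr>) R"
    "(\<lambda>g. N #> g) ` carrier (G\<lparr>carrier := H\<rparr>) = carrier R"
proof -
  interpret N: normal N G by (rule N(1))
  interpret Q: group "G Mod N" by (rule N.factorgroup_is_group)
  have "{N #> x, N #> y} \<subseteq> carrier (G Mod N)"
    using xy by (auto simp: FactGroup_def intro: rcosetsI[OF N.subset])
  then show "group R"
    unfolding R_def using Q.generate_is_subgroup subgroup.subgroup_is_group Q.group_axioms by blast
  show img: "(\<lambda>g. N #> g) ` carrier (G\<lparr>carrier := H\<rparr>) = carrier R"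
    using image_closed_generate[OF N xy] by (simp add: H_def R_def)
  have "H \<subseteq> carrier G"
    using closed_generate(1)[of "{x, y}"] xy subgroup.subset unfolding H_def by blast
  then show "(\<lambda>g. N #> g) \<in> hom (G\<lparr>carrier := H\<rparr>) R"
    using img N.rcos_sum by (auto simp: hom_def R_def subset_iff)
qed

text \<open>Here \<open>G/M\<close> is a quotient of \<open>G/N\<close>.\<close>

lemma cosets_generate_mono:
  assumes C: "finite_group_class C" "quotient_closed C"
    and N: "N \<lhd> G" "openin T N" and M: "M \<lhd> G" "openin T M" and NM: "N \<subseteq> M"
    and xy: "x \<in> carrier G" "y \<in> carrier G"
    and gen: "cosets_generate C G N (N #> x) (N #> y)"
  shows "cosets_generate C G M (M #> x) (M #> y)"
proof -
  let ?H = "closed_generate G T {x, y}"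
  have H: "subgroup ?H G"
    using closed_generate(1)[of "{x, y}"] xy by auto
  note n = cosets_generate_group[OF N xy] and m = cosets_generate_group[OF M xy]
  show ?thesis
    unfolding cosets_generate_def
  proof (rule in_class_of_kernel_subset[OF C _ n(1) m(1) _ n(2,3) m(2,3)])
    show "group (G\<lparr>carrier := ?H\<rparr>)"
      using H subgroup.subgroup_is_group group_axioms by blast
    show "in_class C ((G Mod N)\<lparr>carrier := generate (G Mod N) {N #> x, N #> y}\<rparr>)"
      using gen by (simp add: cosets_generate_def)
    fix h assume h: "h \<in> carrier (G\<lparr>carrier := ?H\<rparr>)"
      "N #> h = \<one>\<^bsub>(G Mod N)\<lparr>carrier := generate (G Mod N) {N #> x, N #> y}\<rparr>\<^esub>"
    then have hG: "h \<in> carrier G"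
      using H subgroup.subset by force
    then have "h \<in> N"
      using rcos_self[OF hG normal_imp_subgroup[OF N(1)]] h(2) by simp
    then have "M #> h = M"
      using NM coset_join2[OF hG normal_imp_subgroup[OF M(1)]] by blast
    then show "M #> h = \<one>\<^bsub>(G Mod M)\<lparr>carrier := generate (G Mod M) {M #> x, M #> y}\<rparr>\<^esub>"
      by simp
  qed
qed

text \<open>Let \<open>H\<close> be the closed subgroup generated by \<open>x\<close> and \<open>y\<close>. Its image in \<open>G/N\<close> is its quotient by
  the open normal subgroup \<open>H \<inter> N\<close>. Conversely, each open normal subgroup of \<open>H\<close> contains such an
  intersection.\<close>

lemma generates_pro_class_iff:
  assumes C: "finite_group_class C" "quotient_closed C"
    and xy: "x \<in> carrier G" "y \<in> carrier G"
  shows "generates_pro_class C G T x y \<longleftrightarrow>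
    (\<forall>N. N \<lhd> G \<and> openin T N \<longrightarrow> cosets_generate C G N (N #> x) (N #> y))"
proof -
  define H where "H = closed_generate G T {x, y}"
  let ?H = "G\<lparr>carrier := H\<rparr>"
  have H: "subgroup H G" "closedin T H"
    using closed_generate(1,2)[of "{x, y}"] xy by (auto simp: H_def)
  have gH: "group ?H"
    using H(1) subgroup.subgroup_is_group group_axioms by blast
  have HG: "H \<subseteq> carrier G"
    using H(1) subgroup.subset by blast
  note quot = cosets_generate_group[OF _ _ xy, folded H_def]
  show ?thesis
  proof (intro iffI allI impI)
    fix N assume pro: "generates_pro_class C G T x y" and N: "N \<lhd> G \<and> openin T N"
    let ?R = "(G Mod N)\<lparr>carrier := generate (G Mod N) {N #> x, N #> y}\<rparr>"
    interpret q: group_hom ?H ?R "\<lambda>g. N #> g"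
      using gH quot(1,2)[of N] N by (simp add: group_hom_def group_hom_axioms_def)
    have sg: "subgroup N G"
      using N normal_imp_subgroup by blast
    have "kernel ?H ?R (\<lambda>g. N #> g) = H \<inter> N"
      using HG rcos_self[OF _ sg] coset_join2[OF _ sg] by (force simp: kernel_def)
    then have "kernel ?H ?R (\<lambda>g. N #> g) \<lhd> ?H" "openin (subtopology T H) (kernel ?H ?R (\<lambda>g. N #> g))"
      using q.normal_kernel N by (auto simp: openin_subtopology_Int2)
    then have "in_class C (?H Mod kernel ?H ?R (\<lambda>g. N #> g))"
      using pro by (simp add: generates_pro_class_def pro_class_def Let_def H_def)
    then show "cosets_generate C G N (N #> x) (N #> y)"
      unfolding cosets_generate_def
      by (rule in_class_iso[OF _ q.FactGroup_iso]) (use quot[of N] N in auto)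
  next
    assume gen: "\<forall>N. N \<lhd> G \<and> openin T N \<longrightarrow> cosets_generate C G N (N #> x) (N #> y)"
    have "in_class C (?H Mod M)" if M: "M \<lhd> ?H" "openin (subtopology T H) M" for M
    proof -
      interpret M: normal M ?H by (rule M(1))
      obtain U where U: "openin T U" "M = U \<inter> H"
        using M(2) by (auto simp: openin_subtopology)
      have "\<one> \<in> U"
        using subgroup.one_closed[OF M.subgroup_axioms] U(2) by simp
      then obtain N where N: "N \<lhd> G" "openin T N" "N \<subseteq> U"
        using open_normal_subset U(1) by metis
      let ?R = "(G Mod N)\<lparr>carrier := generate (G Mod N) {N #> x, N #> y}\<rparr>"
      show ?thesis
      proof (rule in_class_of_kernel_subset[OF C gH quot(1)[OF N(1,2)] M.factorgroup_is_group _
            quot(2,3)[OF N(1,2)] M.r_coset_hom_Mod])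
        show "in_class C ?R"
          using gen N by (simp add: cosets_generate_def)
        show "(\<lambda>g. M #>\<^bsub>?H\<^esub> g) ` carrier ?H = carrier (?H Mod M)"
          by (auto simp: FactGroup_def RCOSETS_def)
        fix h assume h: "h \<in> carrier ?H" "N #> h = \<one>\<^bsub>?R\<^esub>"
        then have "h \<in> N"
          using HG rcos_self[OF _ normal_imp_subgroup[OF N(1)], of h] by auto
        then have "h \<in> M"
          using h(1) N(3) U(2) by auto
        then show "M #>\<^bsub>?H\<^esub> h = \<one>\<^bsub>?H Mod M\<^esub>"
          using group.coset_join2[OF gH h(1) M.subgroup_axioms] by simp
      qed
    qed
    then show "generates_pro_class C G T x y"
      using closed_subgroup_profinite[OF H]
      by (simp add: generates_pro_class_def pro_class_def Let_def H_def[symmetric])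
  qed
qed

end

section \<open>Haar measure on unions of cosets\<close>

text \<open>The outer regularity equation loops as a rewrite rule, as its right-hand side contains measures of
  open sets; the properties are therefore stated separately.\<close>

lemma normalized_haarD:
  assumes "normalized_haar K S \<kappa>"
  shows "space \<kappa> = carrier K"
    and "sets \<kappa> = sigma_sets (carrier K) {U. openin S U}"
    and "emeasure \<kappa> (carrier K) = 1"
    and "\<lbrakk>g \<in> carrier K; A \<in> sets \<kappa>\<rbrakk> \<Longrightarrow> emeasure \<kappa> (g <#\<^bsub>K\<^esub> A) = emeasure \<kappa> A"
    and "A \<in> sets \<kappa> \<Longrightarrow> emeasure \<kappa> A = (INF U\<in>{U. openin S U \<and> A \<subseteq> U}. emeasure \<kappa> U)"
  using assms unfolding normalized_haar_def by blast+

lemma haar_sets: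
  assumes haar: "normalized_haar K S \<kappa>" and top: "topspace S = carrier K"
  shows "openin S U \<Longrightarrow> U \<in> sets \<kappa>" "closedin S D \<Longrightarrow> D \<in> sets \<kappa>"
proof -
  show op: "U \<in> sets \<kappa>" if "openin S U" for U
    using normalized_haarD(2)[OF haar] that by auto
  assume D: "closedin S D"
  then have "D = space \<kappa> - (carrier K - D)"
    using closedin_subset[OF D] top normalized_haarD(1)[OF haar] by auto
  also have "\<dots> \<in> sets \<kappa>"
    using op[of "carrier K - D"] D top by (intro sets.compl_sets) (simp add: closedin_def)
  finally show "D \<in> sets \<kappa>" .
qed

lemma haar_finite_measure:
  assumes "normalized_haar K S \<kappa>"
  shows "finite_measure \<kappa>" "measure \<kappa> (carrier K) = 1"
  using normalized_haarD(1,3)[OF assms] by (auto intro!: finite_measureI simp: measure_def)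

lemma measure_Union_translates:
  assumes haar: "normalized_haar K S \<kappa>" and A: "A \<in> sets \<kappa>"
    and \<B>: "finite \<B>" "pairwise disjnt \<B>"
    and tr: "\<And>B. B \<in> \<B> \<Longrightarrow> B \<in> sets \<kappa> \<and> (\<exists>g\<in>carrier K. B = g <#\<^bsub>K\<^esub> A)"
  shows "measure \<kappa> (\<Union>\<B>) = card \<B> * measure \<kappa> A"
proof -
  interpret finite_measure \<kappa>
    by (rule haar_finite_measure[OF haar])
  have "measure \<kappa> B = measure \<kappa> A" if B: "B \<in> \<B>" for B
  proof -
    have "emeasure \<kappa> B = emeasure \<kappa> A"
      using tr[OF B] normalized_haarD(4)[OF haar _ A] by auto
    then show ?thesis
      by (simp add: measure_def)
  qed
  moreover have "measure \<kappa> (\<Union>B\<in>\<B>. B) = (\<Sum>B\<in>\<B>. measure \<kappa> B)"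
    using \<B> tr by (intro finite_measure_finite_Union)
      (auto simp: disjoint_family_on_def pairwise_def disjnt_def)
  ultimately show ?thesis
    by simp
qed

context profinite
begin

lemma measure_Union_rcosets:
  assumes haar: "normalized_haar G T \<mu>" and N: "N \<lhd> G" "openin T N" and A: "\<A> \<subseteq> rcosets N"
  shows "measure \<mu> (\<Union>\<A>) = card \<A> / card (rcosets N)"
proof -
  interpret N: normal N G by (rule N(1))
  have *: "measure \<mu> (\<Union>\<B>) = card \<B> * measure \<mu> N" if "\<B> \<subseteq> rcosets N" for \<B>
  proof (rule measure_Union_translates[OF haar])
    show "N \<in> sets \<mu>"
      using haar_sets(1)[OF haar topspace N(2)] .
    show "finite \<B>"
      using finite_rcosets[OF N] that finite_subset by blast
    show "pairwise disjnt \<B>"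
      using rcos_disjoint[OF N.is_subgroup] that pairwise_subset by blast
    fix B assume "B \<in> \<B>"
    then have B: "B \<in> rcosets N"
      using that by blast
    then show "B \<in> sets \<mu> \<and> (\<exists>g\<in>carrier G. B = g <# N)"
      using haar_sets(1)[OF haar topspace openin_rcoset[OF N B]] N.coset_eq
      by (auto simp: RCOSETS_def)
  qed
  have "card (rcosets N) * measure \<mu> N = 1"
    using *[of "rcosets N"] haar_finite_measure(2)[OF haar] rcosets_part_G[OF N.is_subgroup] by simp
  then have "measure \<mu> N = 1 / card (rcosets N)"
    by (auto simp: eq_divide_eq mult.commute)
  then show ?thesis
    using *[OF A] by simp
qed

text \<open>The \<open>r\<^sup>2\<close> products of two of the \<open>r\<close> cosets of \<open>N\<close> partition \<open>G \<times> G\<close> into translates of \<open>N \<times> N\<close>.\<close>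

lemma measure_Union_rcosets_prod:
  assumes haar: "normalized_haar (G \<times>\<times> G) (prod_topology T T) \<nu>"
    and N: "N \<lhd> G" "openin T N" and R: "R \<subseteq> (rcosets N) \<times> (rcosets N)"
  shows "measure \<nu> (\<Union>(A, B)\<in>R. A \<times> B) = card R / (card (rcosets N))\<^sup>2"
proof -
  interpret N: normal N G by (rule N(1))
  have top: "topspace (prod_topology T T) = carrier (G \<times>\<times> G)"
    by simp
  have disj: "A = B" if "A \<in> rcosets N" "B \<in> rcosets N" "x \<in> A" "x \<in> B" for A B x
    using pairwiseD[OF rcos_disjoint[OF N.is_subgroup] that(1,2)] that(3,4) by (auto simp: disjnt_iff)
  have ne: "A \<noteq> {}" if "A \<in> rcosets N" for A
    using N.rcosets_non_empty that by blast
  let ?t = "\<lambda>(A, B). A \<times> B"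
  have *: "measure \<nu> (\<Union>(?t ` R)) = card R * measure \<nu> (N \<times> N)"
    if R: "R \<subseteq> (rcosets N) \<times> (rcosets N)" for R
  proof -
    have "inj_on ?t R"
    proof (rule inj_onI)
      fix p q assume "p \<in> R" "q \<in> R" "?t p = ?t q"
      moreover from this(1,2) have "fst p \<noteq> {}" "snd p \<noteq> {}"
        using R ne by force+
      ultimately show "p = q"
        by (auto simp: case_prod_beta times_eq_iff prod_eq_iff)
    qed
    then have "card (?t ` R) = card R"
      by (rule card_image)
    moreover have "measure \<nu> (\<Union>(?t ` R)) = card (?t ` R) * measure \<nu> (N \<times> N)"
    proof (rule measure_Union_translates[OF haar])
      show "N \<times> N \<in> sets \<nu>"
        using haar_sets(1)[OF haar top] N(2) by (simp add: openin_prod_Times_iff)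
      show "finite (?t ` R)"
        using finite_rcosets[OF N] R by (intro finite_imageI) (auto intro: finite_subset)
      show "pairwise disjnt (?t ` R)"
      proof (rule pairwiseI)
        fix D1 D2 assume D: "D1 \<in> ?t ` R" "D2 \<in> ?t ` R" "D1 \<noteq> D2"
        then obtain A1 B1 A2 B2 where AB: "(A1, B1) \<in> R" "D1 = A1 \<times> B1" "(A2, B2) \<in> R" "D2 = A2 \<times> B2"
          by auto
        with R have "A1 \<in> rcosets N" "A2 \<in> rcosets N" "B1 \<in> rcosets N" "B2 \<in> rcosets N"
          by auto
        with D(3) show "disjnt D1 D2"
          unfolding AB(2,4) disjnt_iff using disj by blast
      qed
      fix D assume "D \<in> ?t ` R"
      then obtain A B where AB: "D = A \<times> B" "A \<in> rcosets N" "B \<in> rcosets N"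
        using R by auto
      then obtain g h where gh: "g \<in> carrier G" "A = g <# N" "h \<in> carrier G" "B = h <# N"
        using N.coset_eq by (auto simp: RCOSETS_def)
      have "D \<in> sets \<nu>"
        using haar_sets(1)[OF haar top] AB openin_rcoset[OF N] by (simp add: openin_prod_Times_iff)
      moreover have "D = (g, h) <#\<^bsub>G \<times>\<times> G\<^esub> (N \<times> N)"
        by (force simp: AB(1) gh(2,4) l_coset_def)
      ultimately show "D \<in> sets \<nu> \<and> (\<exists>g\<in>carrier (G \<times>\<times> G). D = g <#\<^bsub>G \<times>\<times> G\<^esub> (N \<times> N))"
        using gh by auto
    qed
    ultimately show ?thesis
      by simp
  qed
  have "\<Union>(?t ` ((rcosets N) \<times> (rcosets N))) = carrier G \<times> carrier G"
    unfolding rcosets_part_G[OF N.is_subgroup, symmetric] by auto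
  then have "(card (rcosets N))\<^sup>2 * measure \<nu> (N \<times> N) = 1"
    using *[of "(rcosets N) \<times> (rcosets N)"] haar_finite_measure(2)[OF haar]
    by (simp add: card_cartesian_product power2_eq_square)
  then have "measure \<nu> (N \<times> N) = 1 / (card (rcosets N))\<^sup>2"
    by (auto simp: eq_divide_eq mult.commute)
  then show ?thesis
    using *[OF R] by simp
qed

text \<open>Let \<open>R\<close> be a relation between cosets of \<open>N\<close>, viewed as a set of pairs of group elements. If its
  fibre over every point of \<open>E\<close> has measure at least \<open>e\<close>, then its own measure is at least \<open>e\<close> times
  that of \<open>E\<close>. The set \<open>E\<close> need not be measurable: the proof passes to the cosets \<open>\<A>\<close> whose fibre is
  that large, and these cover \<open>E\<close>.\<close>

lemma measure_ge_of_fibres_ge: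
  assumes \<mu>: "normalized_haar G T \<mu>" and \<nu>: "normalized_haar (G \<times>\<times> G) (prod_topology T T) \<nu>"
    and N: "N \<lhd> G" "openin T N" and R: "R \<subseteq> (rcosets N) \<times> (rcosets N)"
    and E: "E \<subseteq> carrier G" and e: "e \<ge> 0"
    and fib: "\<And>x. x \<in> E \<Longrightarrow> e \<le> measure \<mu> (\<Union>(R `` {N #> x}))"
  shows "e * measure \<mu> E \<le> measure \<nu> (\<Union>(A, B)\<in>R. A \<times> B)"
proof -
  interpret \<mu>: finite_measure \<mu>
    by (rule haar_finite_measure[OF \<mu>])
  define r where "r = real (card (rcosets N))"
  have sg: "subgroup N G"
    using N(1) normal_imp_subgroup by blast
  have fin: "finite (rcosets N)"
    using finite_rcosets[OF N] .
  have "rcosets N \<noteq> {}"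
    using rcosets_part_G[OF sg] by auto
  with fin have r: "r > 0"
    by (simp add: r_def card_gt_0_iff)
  define \<A> where "\<A> = {A \<in> rcosets N. e \<le> measure \<mu> (\<Union>(R `` {A}))}"
  have A: "\<A> \<subseteq> rcosets N"
    by (auto simp: \<A>_def)
  have "E \<subseteq> \<Union>\<A>"
  proof
    fix x assume "x \<in> E"
    then have "N #> x \<in> \<A>" "x \<in> N #> x"
      using E fib rcos_self[OF _ sg] rcosetsI[OF subgroup.subset[OF sg]] by (auto simp: \<A>_def)
    then show "x \<in> \<Union>\<A>"
      by blast
  qed
  then have "measure \<mu> E \<le> measure \<mu> (\<Union>\<A>)"
    using haar_sets(1)[OF \<mu> topspace openin_Union_rcosets[OF N A]] by (rule \<mu>.finite_measure_mono)
  also have "\<dots> = card \<A> / r"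
    using measure_Union_rcosets[OF \<mu> N A] by (simp add: r_def)
  finally have ED: "measure \<mu> E \<le> card \<A> / r" .
  have "e * r \<le> card (R `` {A})" if "A \<in> \<A>" for A
  proof -
    have "R `` {A} \<subseteq> rcosets N"
      using R by auto
    then have "measure \<mu> (\<Union>(R `` {A})) = card (R `` {A}) / r"
      using measure_Union_rcosets[OF \<mu> N] by (simp add: r_def)
    with that r show ?thesis
      by (simp add: \<A>_def field_simps)
  qed
  then have "card \<A> * (e * r) \<le> (\<Sum>A\<in>\<A>. real (card (R `` {A})))"
    using sum_bounded_below[of \<A> "e * r" "\<lambda>A. real (card (R `` {A}))"] by simp
  also have "\<dots> = card (SIGMA A:\<A>. R `` {A})"
    using fin R A by (subst card_SigmaI) (auto intro: finite_subset)
  also have "\<dots> \<le> card R"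
    using fin R by (intro of_nat_mono card_mono) (auto intro: finite_subset)
  finally have "card \<A> * (e * r) \<le> card R" .
  have "e * measure \<mu> E \<le> e * (card \<A> / r)"
    using ED e by (rule mult_left_mono)
  also have "\<dots> = card \<A> * (e * r) / r\<^sup>2"
    using r by (simp add: power2_eq_square)
  also have "\<dots> \<le> card R / r\<^sup>2"
    using \<open>card \<A> * (e * r) \<le> card R\<close> by (intro divide_right_mono) auto
  also have "\<dots> = measure \<nu> (\<Union>(A, B)\<in>R. A \<times> B)"
    using measure_Union_rcosets_prod[OF \<nu> N R] by (simp add: r_def)
  finally show ?thesis .
qed

end

section \<open>Positivity of the probability\<close>

theorem theorem1:
  fixes C :: "nat monoid set"
    and G :: "('a, 'b) monoid_scheme" and T :: "'a topology"
    and \<mu> :: "'a measure" and \<nu> :: "('a \<times> 'a) measure"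
  assumes "finite_group_class C"
    and "subgroup_closed C" and "quotient_closed C" and "product_closed C"
    and "profinite_group G T"
    and "normalized_haar G T \<mu>"
    and "normalized_haar (G \<times>\<times> G) (prod_topology T T) \<nu>"
    and "class_positive C G T \<mu>"
  shows "P_group C G T \<nu> > 0"
proof -
  note C = assms(1,3) and \<mu> = assms(6) and \<nu> = assms(7)
  interpret profinite G T
    by unfold_locales (rule assms(5))
  interpret \<mu>: finite_measure \<mu>
    by (rule haar_finite_measure[OF \<mu>])
  interpret \<nu>: finite_measure \<nu>
    by (rule haar_finite_measure[OF \<nu>])
  have top2: "topspace (prod_topology T T) = carrier (G \<times>\<times> G)"
    by simp
  define F where "F = {N. N \<lhd> G \<and> openin T N}"
  define R where "R N = {(A, B) \<in> (rcosets\<^bsub>G\<^esub> N) \<times> (rcosets\<^bsub>G\<^esub> N). cosets_generate C G N A B}" for N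
  define W where "W N = (\<Union>(A, B)\<in>R N. A \<times> B)" for N
  have R: "R N \<subseteq> (rcosets\<^bsub>G\<^esub> N) \<times> (rcosets\<^bsub>G\<^esub> N)" for N
    by (auto simp: R_def)
  have GF: "carrier G \<in> F"
    using normal_invI[OF subgroup_self] openin_topspace[of T] by (simp add: F_def)
  have NF: "N \<lhd> G" "openin T N" "subgroup N G" if "N \<in> F" for N
    using that normal_imp_subgroup by (auto simp: F_def)
  have coset: "x \<in> N #>\<^bsub>G\<^esub> x" "N #>\<^bsub>G\<^esub> x \<in> rcosets\<^bsub>G\<^esub> N" if "N \<in> F" "x \<in> carrier G" for N x
    using rcos_self[OF that(2) NF(3)] rcosetsI[OF subgroup.subset[OF NF(3)] that(2)] that(1) by auto
  have coset_eq: "A = N #>\<^bsub>G\<^esub> x" if N: "N \<in> F" and A: "A \<in> rcosets\<^bsub>G\<^esub> N" "x \<in> A" for N A x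
  proof -
    obtain g where "g \<in> carrier G" "A = N #>\<^bsub>G\<^esub> g"
      using A(1) by (auto simp: RCOSETS_def)
    then show ?thesis
      using repr_independence[OF _ _ NF(3)[OF N]] A(2) by simp
  qed
  have W: "(x, y) \<in> W N \<longleftrightarrow> cosets_generate C G N (N #>\<^bsub>G\<^esub> x) (N #>\<^bsub>G\<^esub> y)"
    if "N \<in> F" "x \<in> carrier G" "y \<in> carrier G" for x y N
  proof
    assume "(x, y) \<in> W N"
    then obtain A B where AB: "(A, B) \<in> R N" "x \<in> A" "y \<in> B"
      by (auto simp: W_def)
    then have "A = N #>\<^bsub>G\<^esub> x" "B = N #>\<^bsub>G\<^esub> y"
      using R[of N] coset_eq[OF that(1), of A x] coset_eq[OF that(1), of B y] by auto
    with AB(1) show "cosets_generate C G N (N #>\<^bsub>G\<^esub> x) (N #>\<^bsub>G\<^esub> y)"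
      by (simp add: R_def)
  next
    assume "cosets_generate C G N (N #>\<^bsub>G\<^esub> x) (N #>\<^bsub>G\<^esub> y)"
    then show "(x, y) \<in> W N"
      using coset[OF that(1,2)] coset[OF that(1,3)] by (auto simp: W_def R_def)
  qed
  have WG: "W N \<subseteq> carrier G \<times> carrier G" if "N \<in> F" for N
    using R rcosets_part_G[OF NF(3)[OF that]] unfolding W_def by blast
  define P where "P = {(x, y) \<in> carrier G \<times> carrier G. generates_pro_class C G T x y}"
  have P: "P = \<Inter>(W ` F)"
  proof -
    have "(x, y) \<in> P \<longleftrightarrow> (\<forall>N\<in>F. (x, y) \<in> W N)" if "x \<in> carrier G" "y \<in> carrier G" for x y
      using that W generates_pro_class_iff[OF C] by (auto simp: P_def F_def)
    then show ?thesis
      using WG[OF GF] GF by (auto simp: P_def)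
  qed
  have clW: "closedin (prod_topology T T) (W N)" if "N \<in> F" for N
  proof -
    have N: "N \<lhd> G" "openin T N"
      using that by (auto simp: F_def)
    have "finite (R N)"
      using finite_rcosets[OF N] R[of N] finite_subset by blast
    moreover have "closedin T A" if "A \<in> rcosets\<^bsub>G\<^esub> N" for A
      using closedin_Union_rcosets[OF N, of "{A}"] that by simp
    ultimately show ?thesis
      unfolding W_def using R[of N]
      by (intro closedin_Union) (auto simp: closedin_prod_Times_iff)
  qed
  have dir: "\<exists>L\<in>F. W L \<subseteq> W M \<inter> W N" if "M \<in> F" "N \<in> F" for M N
  proof (intro bexI subrelI)
    show L: "M \<inter> N \<in> F"
      using that normal_subgroup_intersect by (auto simp: F_def)
    fix x y assume xy: "(x, y) \<in> W (M \<inter> N)"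
    then have "x \<in> carrier G" "y \<in> carrier G"
      using WG[OF L] by auto
    then show "(x, y) \<in> W M \<inter> W N"
      using xy W L that cosets_generate_mono[OF C, of "M \<inter> N"] by (auto simp: F_def)
  qed
  \<comment> \<open>\<open>R N `` {N #> x}\<close> consists of the cosets that make up the fibre of \<open>W N\<close> over \<open>x\<close>.\<close>
  define E where "E m = {x \<in> carrier G. \<forall>N\<in>F. 1 / real (Suc m) \<le> measure \<mu> (\<Union>(R N `` {N #>\<^bsub>G\<^esub> x}))}" for m
  have E_sets: "E m \<in> sets \<mu>" for m
  proof -
    \<comment> \<open>Whether \<open>x\<close> satisfies the condition for \<open>N\<close> depends on its coset only, so \<open>E m\<close> is closed.\<close>
    define V where "V N = \<Union>{A \<in> rcosets\<^bsub>G\<^esub> N. 1 / real (Suc m) \<le> measure \<mu> (\<Union>(R N `` {A}))}" for N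
    have "x \<in> V N \<longleftrightarrow> x \<in> carrier G \<and> 1 / real (Suc m) \<le> measure \<mu> (\<Union>(R N `` {N #>\<^bsub>G\<^esub> x}))"
      if "N \<in> F" for N x
    proof
      assume "x \<in> V N"
      then obtain A where A: "A \<in> rcosets\<^bsub>G\<^esub> N" "x \<in> A" "1 / real (Suc m) \<le> measure \<mu> (\<Union>(R N `` {A}))"
        by (auto simp: V_def)
      moreover have "x \<in> carrier G"
        using A(1,2) rcosets_part_G[OF NF(3)[OF that]] by blast
      ultimately show "x \<in> carrier G \<and> 1 / real (Suc m) \<le> measure \<mu> (\<Union>(R N `` {N #>\<^bsub>G\<^esub> x}))"
        using coset_eq[OF that A(1,2)] by simp
    next
      assume "x \<in> carrier G \<and> 1 / real (Suc m) \<le> measure \<mu> (\<Union>(R N `` {N #>\<^bsub>G\<^esub> x}))"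
      then show "x \<in> V N"
        using coset[OF that] by (auto simp: V_def)
    qed
    then have "E m = \<Inter>(V ` F)"
      using GF by (auto simp: E_def)
    moreover have "closedin T (V N)" if "N \<in> F" for N
      using that unfolding V_def by (intro closedin_Union_rcosets) (auto simp: F_def)
    ultimately have "closedin T (E m)"
      using GF by (auto intro: closedin_Inter)
    then show ?thesis
      using haar_sets(2)[OF \<mu> topspace] by blast
  qed
  have cover: "(\<Union>m. E m) = carrier G"
  proof
    show "carrier G \<subseteq> (\<Union>m. E m)"
    proof
      fix x assume x: "x \<in> carrier G"
      have "measure \<mu> (Omega C G T x) > 0"
        using assms(8) x by (auto simp: class_positive_def P_elem_def)
      then obtain m where m: "1 / real (Suc m) < measure \<mu> (Omega C G T x)"
        by (rule nat_approx_posE)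
      have "1 / real (Suc m) \<le> measure \<mu> (\<Union>(R N `` {N #>\<^bsub>G\<^esub> x}))" if N: "N \<in> F" for N
      proof -
        have "Omega C G T x \<subseteq> \<Union>(R N `` {N #>\<^bsub>G\<^esub> x})"
        proof
          fix g assume g: "g \<in> Omega C G T x"
          then have "g \<in> carrier G" "cosets_generate C G N (N #>\<^bsub>G\<^esub> x) (N #>\<^bsub>G\<^esub> g)"
            using generates_pro_class_iff[OF C x] N by (auto simp: Omega_def F_def)
          then show "g \<in> \<Union>(R N `` {N #>\<^bsub>G\<^esub> x})"
            using coset[OF N] x by (auto simp: R_def)
        qed
        moreover have "\<Union>(R N `` {N #>\<^bsub>G\<^esub> x}) \<in> sets \<mu>"
          using N R[of N] by (intro haar_sets(1)[OF \<mu> topspace] openin_Union_rcosets[of N])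
            (auto simp: F_def)
        ultimately have "measure \<mu> (Omega C G T x) \<le> measure \<mu> (\<Union>(R N `` {N #>\<^bsub>G\<^esub> x}))"
          by (rule \<mu>.finite_measure_mono)
        with m show ?thesis
          by simp
      qed
      then show "x \<in> (\<Union>m. E m)"
        using x by (auto simp: E_def)
    qed
  qed (auto simp: E_def)
  have "\<exists>m. measure \<mu> (E m) > 0"
  proof (rule ccontr)
    assume "\<not> ?thesis"
    then have "measure \<mu> (E m) = 0" for m
      by (simp add: order_antisym not_less)
    then have "emeasure \<mu> (\<Union>m. E m) = 0"
      using E_sets by (intro emeasure_UN_eq_0) (auto simp: \<mu>.emeasure_eq_measure)
    then show False
      using normalized_haarD(3)[OF \<mu>] cover by simp
  qed
  then obtain m where m: "measure \<mu> (E m) > 0" ..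
  define c where "c = 1 / real (Suc m) * measure \<mu> (E m)"
  have c: "c > 0"
    using m by (simp add: c_def)
  have Wc: "c \<le> measure \<nu> (W N)" if "N \<in> F" for N
    unfolding c_def W_def
    using that by (intro measure_ge_of_fibres_ge[OF \<mu> \<nu> _ _ R]) (auto simp: F_def E_def)
  have "closedin (prod_topology T T) P"
    unfolding P using GF clW by (intro closedin_Inter) auto
  then have Ps: "P \<in> sets \<nu>"
    using haar_sets(2)[OF \<nu> top2] by blast
  have "emeasure \<nu> P = (INF U\<in>{U. openin (prod_topology T T) U \<and> P \<subseteq> U}. emeasure \<nu> U)"
    by (rule normalized_haarD(5)[OF \<nu> Ps])
  also have "\<dots> \<ge> ennreal c"
  proof (rule INF_greatest)
    fix U assume "U \<in> {U. openin (prod_topology T T) U \<and> P \<subseteq> U}"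
    then have U: "openin (prod_topology T T) U" "\<Inter>(W ` F) \<subseteq> U"
      by (auto simp: P)
    have "compact_space (prod_topology T T)"
      using compact by (simp add: compact_space_prod_topology)
    then obtain N where N: "N \<in> F" "W N \<subseteq> U"
      using directed_closed_subset_open[OF _ _ clW dir U] GF by auto
    have "ennreal c \<le> emeasure \<nu> (W N)"
      using Wc[OF N(1)] by (simp add: \<nu>.emeasure_eq_measure ennreal_leI)
    also have "\<dots> \<le> emeasure \<nu> U"
      using N(2) haar_sets(1)[OF \<nu> top2 U(1)] by (rule emeasure_mono)
    finally show "ennreal c \<le> emeasure \<nu> U" .
  qed
  finally have "c \<le> measure \<nu> P"
    using c by (simp add: \<nu>.emeasure_eq_measure ennreal_le_iff)
  with c show ?thesis
    by (simp add: P_group_def P_def)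
qed

end
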